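(* Let $g:\mathbb{R}\to\mathbb{R}$ be a locally Lipschitz function. For every differentiability point $u$ of $g$, let $$\varphi_u(x)=\min\Big\{g(u+t)-g(u)-g'(u)t:\ |t|\le x\Big\},\qquad x\ge0.$$ If there are an $\varepsilon>0$ and a dense subset $D\subset\mathbb{R}$ consisting of differentiability points of $g$ such that the function $$u\in D\;\mapsto\;\int_0^\varepsilon\frac{\varphi_u(x)}{x^2}\,dx$$ is bounded on every bounded subset of $D$, then there is a separately convex function $f:\mathbb{R}^2\to\mathbb{R}$ such that $f(u,u)=g(u)$ for each $u\in\mathbb{R}$.
   Context: A function $f:\mathbb{R}^2\to\mathbb{R}$ is called separately convex if it is convex on every line parallel to a coordinate axis. *)

theory Defs
  imports "HOL-Analysis.Analysis"
begin

definition locally_lipschitz :: "(real \<Rightarrow> real) \<Rightarrow> bool" where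
  "locally_lipschitz g \<longleftrightarrow> (\<forall>x. \<exists>e>0. \<exists>L. L-lipschitz_on (ball x e) g)"

text \<open>phi_u(x) = min { g(u+t) - g(u) - g'(u) t : |t| \<le> x } (the min exists since g is continuous).\<close>
definition phi :: "(real \<Rightarrow> real) \<Rightarrow> real \<Rightarrow> real \<Rightarrow> real" where
  "phi g u x = Inf ((\<lambda>t. g (u + t) - g u - deriv g u * t) ` {t. \<bar>t\<bar> \<le> x})"

definition separately_convex :: "(real \<times> real \<Rightarrow> real) \<Rightarrow> bool" where
  "separately_convex f \<longleftrightarrow>
     (\<forall>y. convex_on UNIV (\<lambda>x. f (x, y))) \<and> (\<forall>x. convex_on UNIV (\<lambda>y. f (x, y)))"

end

theory Submission
  imports Defs
begin

text \<open>
  The function \<open>e\<close> equal to \<open>- x y\<close> on \<open>[-1, 1]\<^sup>2\<close> and to \<open>|x - y| - 1\<close> elsewhere is separately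
  convex, satisfies \<open>e (x, y) \<le> |x - y|\<close>, vanishes at the origin and is \<open>- 1\<close> on the diagonal
  outside the unit square. For \<open>u \<in> D\<close>, the sum over the scales \<open>s\<^sub>j = \<delta> / 2\<^sup>j\<close> of
  \<open>- \<phi>\<^sub>u (s\<^sub>j) \<cdot> e (\<cdot> / s\<^sub>j\<^sub>+\<^sub>1)\<close> therefore lies below \<open>\<phi>\<^sub>u (|t|)\<close> on the diagonal, and its growth
  in \<open>|x - y|\<close> is controlled by the sum of \<open>- \<phi>\<^sub>u (s\<^sub>j) / s\<^sub>j\<close>, hence by the integral of \<open>- \<phi>\<^sub>u (x) / x\<^sup>2\<close>.
  Adding the linearisation of \<open>g\<close> at \<open>u\<close> gives a separately convex function that touches \<open>g\<close> from
  below at \<open>(u, u)\<close> on the diagonal near \<open>u\<close>. A further large multiple of \<open>e\<close> at scale \<open>\<delta>\<close> allows it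
  to be glued, by a maximum, to one fixed separately convex function \<open>M\<close> that lies below \<open>g\<close> on the
  diagonal and grows steeply away from it. As only \<open>u\<close> close to a given point matter there, the
  supremum over \<open>u \<in> D\<close> is finite; it is the required function. Stopping the sum over scales at a
  finite stage costs an error \<open>\<phi>\<^sub>u (s\<^sub>n)\<close>, which the supremum absorbs.
\<close>

section \<open>Operations preserving separate convexity\<close>

lemma convex_on_affine_real: "convex_on UNIV (\<lambda>x::real. a * x + b)"
  by (intro convex_onI) (auto simp: algebra_simps)

lemma convex_on_max_real:
  fixes f g :: "real \<Rightarrow> real"
  assumes "convex_on UNIV f" "convex_on UNIV g"
  shows "convex_on UNIV (\<lambda>x. max (f x) (g x))"
proof (rule convex_onI)
  fix t x y :: real
  assume t: "0 < t" "t < 1"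
  have "(1 - t) * f x + t * f y \<le> (1 - t) * max (f x) (g x) + t * max (f y) (g y)"
    "(1 - t) * g x + t * g y \<le> (1 - t) * max (f x) (g x) + t * max (f y) (g y)"
    using t by (intro add_mono mult_left_mono; simp)+
  then show "max (f ((1 - t) *\<^sub>R x + t *\<^sub>R y)) (g ((1 - t) *\<^sub>R x + t *\<^sub>R y))
      \<le> (1 - t) * max (f x) (g x) + t * max (f y) (g y)"
    using convex_onD[OF assms(1), of t x y] convex_onD[OF assms(2), of t x y] t by simp
qed simp

text \<open>The glued function dominates \<open>m\<close> and equals \<open>m\<close> off
  \<open>[a, b]\<close>. A chord of it therefore lies above \<open>m\<close>, and it lies above
  \<open>f\<close> at both ends of the part of \<open>[a, b]\<close> under the chord; convexity of
  \<open>f\<close> settles the points between.\<close>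

lemma convex_on_glue_max:
  fixes f m :: "real \<Rightarrow> real"
  assumes f: "convex_on UNIV f" and m: "convex_on UNIV m"
    and "f a \<le> m a" "f b \<le> m b"
  shows "convex_on UNIV (\<lambda>x. if a \<le> x \<and> x \<le> b then max (f x) (m x) else m x)"
    (is "convex_on UNIV ?G")
proof (rule convex_on_linorderI)
  fix t x y :: real
  assume t: "0 < t" "t < 1" and "x < y"
  define z where "z = (1 - t) * x + t * y"
  \<comment> \<open>\<open>l\<close> is the chord of the glued function over \<open>[x, y]\<close>,
    extended to an affine function.\<close>
  define p where "p = (?G y - ?G x) / (y - x)"
  define l where "l w = ?G x + p * (w - x)" for w
  have mG: "m w \<le> ?G w" for w by simp
  have lx: "l x = ?G x" and ly: "l y = ?G y"
    using \<open>x < y\<close> by (auto simp: l_def p_def)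
  have l_comb: "l ((1 - s) * v + s * w) = (1 - s) * l v + s * l w" for s v w
    by (simp add: l_def algebra_simps)
  have z_le: "x \<le> z" "z \<le> y"
  proof -
    have "z - x = t * (y - x)" "y - z = (1 - t) * (y - x)" by (simp_all add: z_def algebra_simps)
    then show "x \<le> z" "z \<le> y" using t \<open>x < y\<close> by (smt (verit) mult_nonneg_nonneg)+
  qed
  have chord: "h w \<le> l w" if "convex_on UNIV h" "h v \<le> l v" "h v' \<le> l v'" "v \<le> w" "w \<le> v'"
    for h v w v'
  proof (cases "v = v'")
    case False
    define s where "s = (w - v) / (v' - v)"
    have s: "0 \<le> s" "s \<le> 1" using that False by (auto simp: s_def divide_simps)
    have w: "w = (1 - s) * v + s * v'"
    proof -
      have "s * (v' - v) = w - v" using False by (simp add: s_def)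
      then show ?thesis by (simp add: algebra_simps)
    qed
    have "h w \<le> (1 - s) * h v + s * h v'"
      using convex_onD[OF that(1) s, of v v'] w by simp
    also have "\<dots> \<le> (1 - s) * l v + s * l v'"
      using that s by (intro add_mono mult_left_mono) auto
    finally show ?thesis using l_comb w by simp
  qed (use that in auto)
  have ml: "m w \<le> l w" if "x \<le> w" "w \<le> y" for w
    using chord[OF m _ _ that] mG lx ly by simp
  have "?G z \<le> l z"
  proof (cases "a \<le> z \<and> z \<le> b")
    case True
    \<comment> \<open>Each end of the clipped interval is either an end of the chord, where the
      glued function is at least \<open>f\<close>, or one of \<open>a\<close>, \<open>b\<close>,
      where \<open>f\<close> is at most \<open>m\<close>, hence below the chord.\<close>
    have "f (max x a) \<le> l (max x a)"
      using ml[of a] True z_le lx assms(3) by (cases "a \<le> x") auto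
    moreover have "f (min y b) \<le> l (min y b)"
      using ml[of b] True z_le ly assms(4) by (cases "y \<le> b") auto
    ultimately have "f z \<le> l z"
      using chord[OF f, of "max x a" "min y b" z] True z_le by simp
    then show ?thesis using ml z_le True by simp
  next
    case False
    then show ?thesis using ml z_le by auto
  qed
  also have "l z = (1 - t) * ?G x + t * ?G y"
    unfolding z_def l_comb lx ly ..
  finally show "?G ((1 - t) *\<^sub>R x + t *\<^sub>R y) \<le> (1 - t) * ?G x + t * ?G y"
    by (simp only: z_def real_scaleR_def)
qed simp

lemma separately_convex_symmetricI:
  assumes "\<And>x y. f (x, y) = f (y, x)" "\<And>y. convex_on UNIV (\<lambda>x. f (x, y))"
  shows "separately_convex f"
  unfolding separately_convex_def using assms(2) by (simp flip: assms(1))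

lemma separately_convex_add:
  "separately_convex f \<Longrightarrow> separately_convex g \<Longrightarrow> separately_convex (\<lambda>p. f p + g p)"
  by (auto simp: separately_convex_def intro: convex_on_add)

lemma separately_convex_cmult:
  "0 \<le> c \<Longrightarrow> separately_convex f \<Longrightarrow> separately_convex (\<lambda>p. c * f p)"
  by (auto simp: separately_convex_def intro: convex_on_cmul)

lemma separately_convex_affine: "separately_convex (\<lambda>(x, y). a * x + b * y + c)"
  unfolding separately_convex_def
  using convex_on_affine_real[of a "b * y + c" for y] convex_on_affine_real[of b "a * x + c" for x]
  by (simp add: ac_simps)

lemma separately_convex_const: "separately_convex (\<lambda>p. c)"
  using separately_convex_affine[of 0 0 c] by (simp add: case_prod_beta')

lemma separately_convex_sum:
  fixes F :: "'i \<Rightarrow> real \<times> real \<Rightarrow> real"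
  assumes "\<And>i. i \<in> I \<Longrightarrow> separately_convex (F i)"
  shows "separately_convex (\<lambda>p. \<Sum>i\<in>I. F i p)"
  using assms
  by (induction I rule: infinite_finite_induct)
    (auto intro: separately_convex_add separately_convex_const)

lemma separately_convex_abs_diff: "separately_convex (\<lambda>(x, y). \<bar>x - y\<bar>)"
proof (rule separately_convex_symmetricI)
  fix y :: real
  show "convex_on UNIV (\<lambda>x. case (x, y) of (x, y) \<Rightarrow> \<bar>x - y\<bar>)"
    using convex_on_dist[of UNIV y] by (simp add: dist_real_def abs_minus_commute)
qed auto

lemma separately_convex_compose_affine:
  assumes "separately_convex f"
  shows "separately_convex (\<lambda>(x, y). f (a * x + b, a * y + b))"
proof -
  have *: "convex_on UNIV (\<lambda>x. h (a * x + b))" if "convex_on UNIV h" for h :: "real \<Rightarrow> real"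
  proof (rule convex_onI)
    fix t x y :: real
    assume "0 < t" "t < 1"
    moreover have "a * ((1 - t) * x + t * y) + b = (1 - t) * (a * x + b) + t * (a * y + b)"
      by (simp add: algebra_simps)
    ultimately show "h (a * ((1 - t) *\<^sub>R x + t *\<^sub>R y) + b)
        \<le> (1 - t) * h (a * x + b) + t * h (a * y + b)"
      using convex_onD[OF that, of t "a * x + b" "a * y + b"] by simp
  qed simp
  show ?thesis
    using assms unfolding separately_convex_def by (auto intro: *)
qed

section \<open>Suprema, gluing over squares, and locally finite sums\<close>

lemma separately_convex_Sup:
  fixes F :: "'i \<Rightarrow> real \<times> real \<Rightarrow> real"
  assumes "I \<noteq> {}" "\<And>i. i \<in> I \<Longrightarrow> separately_convex (F i)"
    and bdd: "\<And>p. bdd_above ((\<lambda>i. F i p) ` I)"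
  shows "separately_convex (\<lambda>p. SUP i\<in>I. F i p)"
proof -
  have *: "convex_on UNIV (\<lambda>x. SUP i\<in>I. h i x)"
    if h: "\<And>i. i \<in> I \<Longrightarrow> convex_on UNIV (h i)" and b: "\<And>x. bdd_above ((\<lambda>i. h i x) ` I)"
    for h :: "'i \<Rightarrow> real \<Rightarrow> real"
  proof (rule convex_onI)
    fix t x y :: real
    assume t: "0 < t" "t < 1"
    show "(SUP i\<in>I. h i ((1 - t) *\<^sub>R x + t *\<^sub>R y))
        \<le> (1 - t) * (SUP i\<in>I. h i x) + t * (SUP i\<in>I. h i y)"
    proof (rule cSUP_least)
      fix i assume "i \<in> I"
      have "h i ((1 - t) *\<^sub>R x + t *\<^sub>R y) \<le> (1 - t) * h i x + t * h i y"
        using convex_onD[OF h[OF \<open>i \<in> I\<close>]] t by auto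
      also have "\<dots> \<le> (1 - t) * (SUP i\<in>I. h i x) + t * (SUP i\<in>I. h i y)"
        using t \<open>i \<in> I\<close> by (intro add_mono mult_left_mono cSUP_upper b) auto
      finally show "h i ((1 - t) *\<^sub>R x + t *\<^sub>R y)
        \<le> (1 - t) * (SUP i\<in>I. h i x) + t * (SUP i\<in>I. h i y)" .
    qed fact
  qed simp
  show ?thesis
    using assms(2) bdd unfolding separately_convex_def by (auto intro!: *)
qed

text \<open>A line parallel to an axis either misses the square or meets it in an interval whose
  ends lie on the boundary, so the one-dimensional gluing applies to each line.\<close>

lemma separately_convex_glue_max:
  assumes F: "separately_convex F" and M: "separately_convex M"
    and boundary: "\<And>x y. \<bar>x - u\<bar> \<le> d \<Longrightarrow> \<bar>y - u\<bar> \<le> d \<Longrightarrow>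
      \<bar>x - u\<bar> = d \<or> \<bar>y - u\<bar> = d \<Longrightarrow> F (x, y) \<le> M (x, y)"
  shows "separately_convex (\<lambda>(x, y).
    if \<bar>x - u\<bar> \<le> d \<and> \<bar>y - u\<bar> \<le> d then max (F (x, y)) (M (x, y)) else M (x, y))"
proof -
  \<comment> \<open>\<open>P\<close> states that the fixed coordinate is in range; it is constant
    along the line.\<close>
  have *: "convex_on UNIV (\<lambda>x. if \<bar>x - u\<bar> \<le> d \<and> P then max (f x) (m x) else m x)"
    if "convex_on UNIV f" "convex_on UNIV m"
      and "\<And>x. P \<Longrightarrow> \<bar>x - u\<bar> = d \<Longrightarrow> f x \<le> m x" for f m :: "real \<Rightarrow> real" and P
  proof (cases "P \<and> 0 \<le> d")
    case True
    have "\<bar>x - u\<bar> \<le> d \<longleftrightarrow> u - d \<le> x \<and> x \<le> u + d" for x by auto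
    then show ?thesis
      using convex_on_glue_max[OF that(1,2), of "u - d" "u + d"] that(3) True by simp
  next
    case False
    then have "(\<lambda>x. if \<bar>x - u\<bar> \<le> d \<and> P then max (f x) (m x) else m x) = m"
      by (auto simp: fun_eq_iff)
    then show ?thesis using that(2) by simp
  qed
  have "convex_on UNIV (\<lambda>x. if \<bar>x - u\<bar> \<le> d \<and> \<bar>y - u\<bar> \<le> d
      then max (F (x, y)) (M (x, y)) else M (x, y))" for y
    using F M by (intro *) (auto simp: separately_convex_def intro: boundary)
  moreover have "convex_on UNIV (\<lambda>y. if \<bar>y - u\<bar> \<le> d \<and> \<bar>x - u\<bar> \<le> d
      then max (F (x, y)) (M (x, y)) else M (x, y))" for x
    using F M by (intro *) (auto simp: separately_convex_def intro: boundary)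
  ultimately show ?thesis
    unfolding separately_convex_def by (simp add: conj_commute)
qed

text \<open>Convexity is an inequality between three points. These lie in a common square around the
  origin, on which the series is one fixed finite sum.\<close>

lemma separately_convex_locally_finite_sum:
  fixes F :: "nat \<Rightarrow> real \<times> real \<Rightarrow> real"
  assumes F: "\<And>n. separately_convex (F n)"
    and supp: "\<And>n x y. \<bar>x\<bar> \<le> real n \<Longrightarrow> \<bar>y\<bar> \<le> real n \<Longrightarrow> F n (x, y) = 0"
  obtains S where "separately_convex S"
    "\<And>N x y. \<bar>x\<bar> \<le> real N \<Longrightarrow> \<bar>y\<bar> \<le> real N \<Longrightarrow> S (x, y) = (\<Sum>n<N. F n (x, y))"
proof
  define S where "S = (\<lambda>(x, y). \<Sum>n<nat \<lceil>max \<bar>x\<bar> \<bar>y\<bar>\<rceil>. F n (x, y))"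
  show S: "S (x, y) = (\<Sum>n<N. F n (x, y))" if "\<bar>x\<bar> \<le> real N" "\<bar>y\<bar> \<le> real N" for N x y
    unfolding S_def prod.case
  proof (rule sum.mono_neutral_left)
    show "{..<nat \<lceil>max \<bar>x\<bar> \<bar>y\<bar>\<rceil>} \<subseteq> {..<N}" using that by (auto simp: nat_le_iff ceiling_le_iff)
    show "\<forall>i\<in>{..<N} - {..<nat \<lceil>max \<bar>x\<bar> \<bar>y\<bar>\<rceil>}. F i (x, y) = 0"
    proof
      fix i assume "i \<in> {..<N} - {..<nat \<lceil>max \<bar>x\<bar> \<bar>y\<bar>\<rceil>}"
      then have "max \<bar>x\<bar> \<bar>y\<bar> \<le> real i" by (simp add: nat_le_iff ceiling_le_iff)
      then show "F i (x, y) = 0" by (intro supp) auto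
    qed
  qed auto
  have sums: "separately_convex (\<lambda>p. \<Sum>n<N. F n p)" for N
    by (intro separately_convex_sum F)
  \<comment> \<open>\<open>c\<close> stands for the absolute value of the fixed coordinate, so
    \<open>N\<close> can be taken large for it and for the three points at once.\<close>
  have *: "convex_on UNIV h"
    if "\<And>N. convex_on UNIV (H N)" "\<And>N x. c \<le> real N \<Longrightarrow> \<bar>x\<bar> \<le> real N \<Longrightarrow> h x = H N x"
    for h :: "real \<Rightarrow> real" and H c
  proof (rule convex_onI)
    fix t x y :: real
    assume t: "0 < t" "t < 1"
    let ?z = "(1 - t) *\<^sub>R x + t *\<^sub>R y"
    obtain N :: nat where "max c (max \<bar>x\<bar> (max \<bar>y\<bar> \<bar>?z\<bar>)) \<le> real N"
      using real_arch_simple by blast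
    then have "c \<le> real N" "\<bar>x\<bar> \<le> real N" "\<bar>y\<bar> \<le> real N" "\<bar>?z\<bar> \<le> real N"
      unfolding max.bounded_iff by blast+
    then have "h x = H N x" "h y = H N y" "h ?z = H N ?z"
      by (blast intro: that(2))+
    then show "h ?z \<le> (1 - t) * h x + t * h y"
      using convex_onD[OF that(1)[of N], of t x y] t by simp
  qed simp
  have fst: "convex_on UNIV (\<lambda>x. \<Sum>n<N. F n (x, y))"
    and snd: "convex_on UNIV (\<lambda>x. \<Sum>n<N. F n (y, x))" for N y
    using sums by (simp_all add: separately_convex_def)
  have "convex_on UNIV (\<lambda>x. S (x, y))" for y
    by (rule *[where c = "\<bar>y\<bar>", OF fst]) (rule S; assumption)
  moreover have "convex_on UNIV (\<lambda>x. S (y, x))" for y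
    by (rule *[where c = "\<bar>y\<bar>", OF snd]) (rule S; assumption)
  ultimately show "separately_convex S"
    unfolding separately_convex_def by blast
qed

section \<open>Elementary separately convex functions\<close>

definition saddle :: "real \<times> real \<Rightarrow> real" where
  "saddle = (\<lambda>(x, y). if \<bar>x\<bar> \<le> 1 \<and> \<bar>y\<bar> \<le> 1 then - (x * y) else \<bar>x - y\<bar> - 1)"

text \<open>The two expressions differ by a product of linear factors,
  \<open>(x - 1) * (1 + y)\<close> or \<open>(x + 1) * (1 - y)\<close> up to sign, whose sign in the
  strip depends only on the position of \<open>x\<close> relative to \<open>1\<close> or
  \<open>- 1\<close>. Within the strip this exhibits \<open>saddle\<close> as a maximum of convex
  functions of \<open>x\<close>.\<close>

lemma saddle_eq_max:
  assumes "\<bar>y\<bar> \<le> 1"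
  shows "saddle (x, y) = max (\<bar>x - y\<bar> - 1) (- (x * y))"
proof -
  have right: "x - y - 1 = - (x * y) + (x - 1) * (1 + y)" by (simp add: algebra_simps)
  have left: "y - x - 1 = - (x * y) - (x + 1) * (1 - y)" by (simp add: algebra_simps)
  consider "\<bar>x\<bar> \<le> 1" | "1 < x" | "x < - 1" by linarith
  then show ?thesis
  proof cases
    case 1
    then have "(x - 1) * (1 + y) \<le> 0" "0 \<le> (x + 1) * (1 - y)"
      using assms by (auto intro!: mult_nonpos_nonneg mult_nonneg_nonneg)
    then have "x - y - 1 \<le> - (x * y)" "y - x - 1 \<le> - (x * y)"
      unfolding right left by linarith+
    then have "\<bar>x - y\<bar> - 1 \<le> - (x * y)" by linarith
    then show ?thesis using 1 assms by (simp add: saddle_def)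
  next
    case 2
    then have "0 \<le> (x - 1) * (1 + y)" using assms by (intro mult_nonneg_nonneg) auto
    then have "- (x * y) \<le> x - y - 1" unfolding right by linarith
    then have "- (x * y) \<le> \<bar>x - y\<bar> - 1" by linarith
    then show ?thesis using 2 by (simp add: saddle_def)
  next
    case 3
    then have "(x + 1) * (1 - y) \<le> 0" using assms by (intro mult_nonpos_nonneg) auto
    then have "- (x * y) \<le> y - x - 1" unfolding left by linarith
    then have "- (x * y) \<le> \<bar>x - y\<bar> - 1" by linarith
    then show ?thesis using 3 by (simp add: saddle_def)
  qed
qed

lemma separately_convex_saddle: "separately_convex saddle"
proof (rule separately_convex_symmetricI)
  fix y :: real
  have c: "convex_on UNIV (\<lambda>x. \<bar>x - y\<bar> - 1)"
    using separately_convex_add[OF separately_convex_abs_diff separately_convex_const[of "-1"]]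
    by (simp add: separately_convex_def)
  show "convex_on UNIV (\<lambda>x. saddle (x, y))"
  proof (cases "\<bar>y\<bar> \<le> 1")
    case True
    then show ?thesis
      using convex_on_max_real[OF c, of "\<lambda>x. - (x * y)"] convex_on_affine_real[of "-y" 0]
      by (simp add: saddle_eq_max mult.commute)
  next
    case False
    then show ?thesis using c by (simp add: saddle_def)
  qed
qed (auto simp: saddle_def)

lemma saddle_boundary: "\<bar>x\<bar> \<le> 1 \<Longrightarrow> \<bar>y\<bar> \<le> 1 \<Longrightarrow> \<bar>x\<bar> = 1 \<or> \<bar>y\<bar> = 1 \<Longrightarrow> saddle (x, y) = \<bar>x - y\<bar> - 1"
  by (auto simp: saddle_def abs_real_def split: if_splits)

lemma saddle_le: "saddle (x, y) \<le> \<bar>x - y\<bar>"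
proof (cases "\<bar>y\<bar> \<le> 1")
  case True
  have "- (x * y) \<le> \<bar>x - y\<bar>"
  proof (cases "x * y < 0")
    case neg: True
    then have "\<bar>x\<bar> \<le> \<bar>x - y\<bar>" by (auto simp: mult_less_0_iff)
    moreover have "- (x * y) \<le> \<bar>x\<bar> * \<bar>y\<bar>" by (metis abs_ge_minus_self abs_mult)
    moreover have "\<bar>x\<bar> * \<bar>y\<bar> \<le> \<bar>x\<bar>" using True by (simp add: mult_left_le)
    ultimately show ?thesis by linarith
  qed auto
  then show ?thesis using True by (simp add: saddle_eq_max)
qed (auto simp: saddle_def)

lemma saddle_diag_nonpos: "saddle (t, t) \<le> 0"
  by (auto simp: saddle_def)

lemma saddle_diag_far: "1 \<le> \<bar>t\<bar> \<Longrightarrow> saddle (t, t) = - 1"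
  by (auto simp: saddle_def abs_real_def split: if_splits)

text \<open>Since \<open>t * t\<close> is at most \<open>\<bar>t\<bar>\<close> in the unit interval,
  subtracting a saddle costs only linearly near the centre. This keeps the supremum close to
  \<open>g\<close> at nearby points of \<open>D\<close>.\<close>

lemma saddle_diag_ge: "- \<bar>t\<bar> \<le> saddle (t, t)"
proof (cases "\<bar>t\<bar> \<le> 1")
  case True
  then have "\<bar>t\<bar> * \<bar>t\<bar> \<le> \<bar>t\<bar>" by (intro mult_left_le) auto
  then show ?thesis using True by (simp add: saddle_def)
qed (auto simp: saddle_def)

section \<open>Quadratic building blocks of the barrier \<open>M\<close>\<close>

text \<open>Pushes the diagonal down beyond the origin while leaving the quadrant of nonpositive
  coordinates untouched, so that shifted copies form a locally finite family.\<close>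

definition wedge :: "real \<times> real \<Rightarrow> real" where
  "wedge = (\<lambda>(x, y). if x \<le> 0 \<and> y \<le> 0 then 0 else - (x * y))"

lemma separately_convex_wedge: "separately_convex wedge"
proof (rule separately_convex_symmetricI)
  fix y :: real
  have c: "convex_on UNIV (\<lambda>x. - (x * y))"
    using convex_on_affine_real[of "-y" 0] by (simp add: mult.commute)
  show "convex_on UNIV (\<lambda>x. wedge (x, y))"
  proof (cases "y \<le> 0")
    case True
    have "wedge (x, y) = max (- (x * y)) 0" for x
      using True by (auto simp: wedge_def max_def mult_le_0_iff not_le zero_le_mult_iff)
    then show ?thesis
      using convex_on_max_real[OF c, of "\<lambda>x. 0"] convex_on_affine_real[of 0 0] by simp
  next
    case False
    then show ?thesis using c by (simp add: wedge_def)
  qed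
qed (auto simp: wedge_def)

text \<open>Counterpart of \<open>wedge\<close> that leaves the diagonal at zero and adds steepness
  in \<open>\<bar>x - y\<bar>\<close> outside the quadrant.\<close>

definition ridge :: "real \<times> real \<Rightarrow> real" where
  "ridge = (\<lambda>(x, y). \<bar>x - y\<bar> * max 0 (max x y))"

lemma separately_convex_ridge: "separately_convex ridge"
proof (rule separately_convex_symmetricI)
  fix y :: real
  define m where "m = max 0 y"
  have pos: "convex_on UNIV (\<lambda>x. max 0 (x - m))"
    using convex_on_max_real[OF convex_on_affine_real[of 0 0] convex_on_affine_real[of 1 "- m"]]
    by simp
  have sq: "convex_on UNIV (\<lambda>x. max 0 (x - m) * max 0 (x - m))"
    by (intro convex_on_mul pos) (auto simp: mono_on_def)
  \<comment> \<open>Up to \<open>m\<close> the function is affine in \<open>x\<close>; beyond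
    \<open>m\<close> it is expanded in powers of \<open>x - m\<close>. The coefficient
    \<open>3 * m - y\<close> of the positive part is nonnegative.\<close>
  have "ridge (x, y) = (- m * x + m * y) + (max 0 (x - m) * max 0 (x - m) + (2 * m - y + m) * max 0 (x - m))" for x
    unfolding ridge_def m_def prod.case max_def by (auto simp: algebra_simps abs_real_def)
  moreover have "convex_on UNIV (\<lambda>x. (- m * x + m * y) + (max 0 (x - m) * max 0 (x - m) + (2 * m - y + m) * max 0 (x - m)))"
    by (intro convex_on_add convex_on_affine_real sq convex_on_cmul pos) (auto simp: m_def)
  ultimately show "convex_on UNIV (\<lambda>x. ridge (x, y))" by simp
qed (auto simp: ridge_def abs_minus_commute max.commute)

lemma wedge_diag_nonpos: "wedge (t, t) \<le> 0"
  by (simp add: wedge_def)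

lemma wedge_diag_far: "1 \<le> t \<Longrightarrow> wedge (t, t) \<le> - 1"
  using mult_mono[of 1 t 1 t] by (simp add: wedge_def)

lemma wedge_ge:
  assumes "\<bar>x\<bar> \<le> c" "\<bar>y\<bar> \<le> c"
  shows "- (c * c) \<le> wedge (x, y)"
proof -
  have "\<bar>x * y\<bar> \<le> c * c" using assms unfolding abs_mult by (intro mult_mono) auto
  then show ?thesis by (auto simp: wedge_def)
qed

lemma ridge_nonneg: "0 \<le> ridge p"
  by (simp add: ridge_def split: prod.split)

lemma ridge_diag: "ridge (t, t) = 0"
  by (simp add: ridge_def)

lemma ridge_far: "1 \<le> max x y \<Longrightarrow> \<bar>x - y\<bar> \<le> ridge (x, y)"
  using mult_left_mono[of 1 "max 0 (max x y)" "\<bar>x - y\<bar>"] by (simp add: ridge_def)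

lemma separately_convex_reflected_shifts:
  assumes "separately_convex w" "0 \<le> c"
  shows "separately_convex (\<lambda>(x, y). c * (w (x - b, y - b) + w (- x - b, - y - b)))"
  using separately_convex_cmult[OF assms(2) separately_convex_add[OF
      separately_convex_compose_affine[OF assms(1), of 1 "- b"]
      separately_convex_compose_affine[OF assms(1), of "- 1" "- b"]]]
  by (simp add: case_prod_unfold)

text \<open>Wedges with corners at \<open>n\<close> and \<open>- n\<close> are summed with weight
  \<open>\<bar>a (Suc n)\<bar>\<close>. Every term is nonpositive on the diagonal, and the term of
  index \<open>N - 1\<close> alone already gives the decrease required at
  \<open>\<bar>t\<bar> \<ge> N\<close>; a constant takes care of \<open>N = 0\<close>.\<close>

lemma ex_separately_convex_below_on_diagonal:
  fixes a :: "nat \<Rightarrow> real"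
  obtains R P where "separately_convex R"
    "\<And>N t. real N \<le> \<bar>t\<bar> \<Longrightarrow> R (t, t) \<le> - a N"
    "\<And>N x y. \<bar>x\<bar> \<le> real N \<Longrightarrow> \<bar>y\<bar> \<le> real N \<Longrightarrow> - P N \<le> R (x, y)"
proof -
  define F where "F n = (\<lambda>(x, y). \<bar>a (Suc n)\<bar> *
    (wedge (x - real n, y - real n) + wedge (- x - real n, - y - real n)))" for n
  have "separately_convex (F n)" for n
    unfolding F_def by (intro separately_convex_reflected_shifts separately_convex_wedge) simp
  moreover have "F n (x, y) = 0" if "\<bar>x\<bar> \<le> real n" "\<bar>y\<bar> \<le> real n" for n x y
    using that by (simp add: F_def wedge_def abs_le_iff)
  ultimately obtain S where S: "separately_convex S"
    "\<And>N x y. \<bar>x\<bar> \<le> real N \<Longrightarrow> \<bar>y\<bar> \<le> real N \<Longrightarrow> S (x, y) = (\<Sum>n<N. F n (x, y))"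
    using separately_convex_locally_finite_sum[of F] by blast
  \<comment> \<open>In the square of half-side \<open>N\<close>, coordinates shifted by
    \<open>n < N\<close> are at most \<open>2 * N\<close> in absolute value, which bounds each of
    the two wedges from below.\<close>
  define P where "P N = \<bar>a 0\<bar> + (\<Sum>n<N. \<bar>a (Suc n)\<bar> * (2 * ((2 * real N) * (2 * real N))))" for N
  have diag: "F n (t, t) \<le> 0" for n t
    unfolding F_def prod.case
    using wedge_diag_nonpos by (intro mult_nonneg_nonpos add_nonpos_nonpos) auto
  show thesis
  proof
    show "separately_convex (\<lambda>p. S p + - \<bar>a 0\<bar>)"
      by (intro separately_convex_add S separately_convex_const)
  next
    fix N :: nat and t :: real
    assume t: "real N \<le> \<bar>t\<bar>"
    obtain K :: nat where K: "\<bar>t\<bar> \<le> real K" using real_arch_simple by blast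
    show "S (t, t) + - \<bar>a 0\<bar> \<le> - a N"
    proof (cases N)
      case 0
      then show ?thesis using sum_nonpos[of "{..<K}" "\<lambda>n. F n (t, t)"] diag S(2)[OF K K] by auto
    next
      case (Suc n)
      then have "n < K" using t K by linarith
      have "wedge (t - real n, t - real n) + wedge (- t - real n, - t - real n) \<le> - 1"
        using t Suc wedge_diag_far[of "t - real n"] wedge_diag_far[of "- t - real n"]
          wedge_diag_nonpos[of "t - real n"] wedge_diag_nonpos[of "- t - real n"] by linarith
      then have "F n (t, t) \<le> \<bar>a (Suc n)\<bar> * - 1"
        unfolding F_def prod.case by (intro mult_left_mono) auto
      moreover have "(\<Sum>i<K. F i (t, t)) = F n (t, t) + (\<Sum>i\<in>{..<K} - {n}. F i (t, t))"
        using \<open>n < K\<close> by (simp add: sum.remove)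
      moreover have "(\<Sum>i\<in>{..<K} - {n}. F i (t, t)) \<le> 0" by (intro sum_nonpos diag)
      ultimately show ?thesis using S(2)[OF K K] unfolding Suc by linarith
    qed
  next
    fix N :: nat and x y :: real
    assume xy: "\<bar>x\<bar> \<le> real N" "\<bar>y\<bar> \<le> real N"
    have "- (\<bar>a (Suc n)\<bar> * (2 * ((2 * real N) * (2 * real N)))) \<le> F n (x, y)" if "n < N" for n
    proof -
      have "- ((2 * real N) * (2 * real N)) \<le> wedge (x - real n, y - real n)"
        "- ((2 * real N) * (2 * real N)) \<le> wedge (- x - real n, - y - real n)"
        using xy that by (intro wedge_ge; linarith)+
      then have "- (2 * ((2 * real N) * (2 * real N)))
          \<le> wedge (x - real n, y - real n) + wedge (- x - real n, - y - real n)" by linarith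
      then show ?thesis
        unfolding F_def prod.case mult_minus_right[symmetric] by (intro mult_left_mono) auto
    qed
    then have "(\<Sum>n<N. - (\<bar>a (Suc n)\<bar> * (2 * ((2 * real N) * (2 * real N))))) \<le> (\<Sum>n<N. F n (x, y))"
      by (intro sum_mono) auto
    then show "- P N \<le> S (x, y) + - \<bar>a 0\<bar>"
      unfolding P_def S(2)[OF xy] by (simp add: sum_negf)
  qed
qed

text \<open>The same weighted sum with ridges in place of wedges: all terms are nonnegative, so one
  term suffices for the lower bound, and all vanish on the diagonal. The summand
  \<open>\<bar>a 0\<bar> * \<bar>x - y\<bar>\<close> supplies the steepness near the origin, where
  the ridges are zero.\<close>

lemma ex_separately_convex_steep:
  fixes a :: "nat \<Rightarrow> real"
  obtains Z where "separately_convex Z" "\<And>t. Z (t, t) = 0"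
    "\<And>N x y. real N \<le> max \<bar>x\<bar> \<bar>y\<bar> \<Longrightarrow> a N * \<bar>x - y\<bar> \<le> Z (x, y)"
proof -
  define F where "F n = (\<lambda>(x, y). \<bar>a (Suc n)\<bar> *
    (ridge (x - real n, y - real n) + ridge (- x - real n, - y - real n)))" for n
  have "separately_convex (F n)" for n
    unfolding F_def by (intro separately_convex_reflected_shifts separately_convex_ridge) simp
  moreover have "F n (x, y) = 0" if "\<bar>x\<bar> \<le> real n" "\<bar>y\<bar> \<le> real n" for n x y
    using that by (simp add: F_def ridge_def abs_le_iff)
  ultimately obtain S where S: "separately_convex S"
    "\<And>N x y. \<bar>x\<bar> \<le> real N \<Longrightarrow> \<bar>y\<bar> \<le> real N \<Longrightarrow> S (x, y) = (\<Sum>n<N. F n (x, y))"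
    using separately_convex_locally_finite_sum[of F] by blast
  have F_nonneg: "0 \<le> F n p" for n p
    by (simp add: F_def ridge_nonneg split: prod.split)
  have F_diag: "F n (t, t) = 0" for n t
    by (simp add: F_def ridge_diag)
  define Z where "Z = (\<lambda>p. S p + \<bar>a 0\<bar> * (case p of (x, y) \<Rightarrow> \<bar>x - y\<bar>))"
  show thesis
  proof
    show "separately_convex Z"
      unfolding Z_def
      by (intro separately_convex_add S separately_convex_cmult separately_convex_abs_diff) simp
  next
    fix t :: real
    obtain K :: nat where "\<bar>t\<bar> \<le> real K" using real_arch_simple by blast
    then show "Z (t, t) = 0" using S(2)[of t K t] by (simp add: Z_def F_diag)
  next
    fix N :: nat and x y :: real
    assume N: "real N \<le> max \<bar>x\<bar> \<bar>y\<bar>"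
    obtain K :: nat where "max \<bar>x\<bar> \<bar>y\<bar> \<le> real K" using real_arch_simple by blast
    then have K: "\<bar>x\<bar> \<le> real K" "\<bar>y\<bar> \<le> real K" by auto
    have a0: "\<bar>a 0\<bar> * \<bar>x - y\<bar> \<ge> 0" by simp
    show "a N * \<bar>x - y\<bar> \<le> Z (x, y)"
    proof (cases N)
      case 0
      have "a N * \<bar>x - y\<bar> \<le> \<bar>a 0\<bar> * \<bar>x - y\<bar>" using 0 by (intro mult_right_mono) auto
      moreover have "0 \<le> S (x, y)" unfolding S(2)[OF K] by (intro sum_nonneg F_nonneg)
      ultimately show ?thesis by (simp add: Z_def)
    next
      case (Suc n)
      then have "n < K" using N K by linarith
      \<comment> \<open>A coordinate of absolute value at least \<open>n + 1\<close> lies one unit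
        past the corner of one of the two ridges.\<close>
      have "1 \<le> max (x - real n) (y - real n) \<or> 1 \<le> max (- x - real n) (- y - real n)"
        using N Suc by linarith
      then have "\<bar>x - y\<bar> \<le> ridge (x - real n, y - real n) + ridge (- x - real n, - y - real n)"
        using ridge_far[of "x - real n" "y - real n"] ridge_far[of "- x - real n" "- y - real n"]
          ridge_nonneg[of "(x - real n, y - real n)"] ridge_nonneg[of "(- x - real n, - y - real n)"]
        by (elim disjE) linarith+
      then have "\<bar>a (Suc n)\<bar> * \<bar>x - y\<bar> \<le> F n (x, y)"
        unfolding F_def prod.case by (intro mult_left_mono) auto
      moreover have "F n (x, y) \<le> (\<Sum>i<K. F i (x, y))"
        using \<open>n < K\<close> by (intro member_le_sum F_nonneg) auto
      moreover have "a N * \<bar>x - y\<bar> \<le> \<bar>a (Suc n)\<bar> * \<bar>x - y\<bar>" using Suc by (intro mult_right_mono) auto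
      ultimately show ?thesis unfolding Z_def S(2)[OF K] prod.case using a0 by linarith
    qed
  qed
qed

section \<open>Superposition of saddles over dyadic scales\<close>

text \<open>If \<open>\<bar>t\<bar>\<close> lies between consecutive scales \<open>s (Suc j)\<close>
  and \<open>s j\<close>, the saddle at scale \<open>s (Suc j)\<close> has reached
  \<open>- 1\<close> on the diagonal, so its term is \<open>- \<psi> (s j)\<close>, at most
  \<open>- \<psi> \<bar>t\<bar>\<close>; the other terms are nonpositive. Below the last scale the
  error \<open>\<psi> (d / 2 ^ n)\<close> compensates.\<close>

lemma separately_convex_dyadic_saddles:
  fixes \<psi> :: "real \<Rightarrow> real" and C :: real
  assumes "0 < d" and nonneg: "\<And>x. 0 \<le> x \<Longrightarrow> 0 \<le> \<psi> x"
    and mono: "\<And>x y. 0 \<le> x \<Longrightarrow> x \<le> y \<Longrightarrow> \<psi> x \<le> \<psi> y"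
    and C: "(\<Sum>j<n. \<psi> (d / 2 ^ j) / (d / 2 ^ Suc j)) \<le> C"
  obtains H where "separately_convex H" "\<And>x y. H (x, y) \<le> C * \<bar>x - y\<bar>"
    "\<And>t. - C * \<bar>t\<bar> \<le> H (t, t)"
    "\<And>t. \<bar>t\<bar> \<le> d \<Longrightarrow> H (t, t) \<le> \<psi> (d / 2 ^ n) - \<psi> \<bar>t\<bar>"
proof
  define s where "s j = d / 2 ^ j" for j :: nat
  have s_pos: "0 < s j" for j using \<open>0 < d\<close> by (simp add: s_def)
  have c_nonneg: "0 \<le> \<psi> (s j)" for j using nonneg s_pos[of j] by simp
  define H where "H = (\<lambda>(x, y). \<Sum>j<n. \<psi> (s j) * saddle (x / s (Suc j), y / s (Suc j)))"
  have C': "(\<Sum>j<n. \<psi> (s j) * (r / s (Suc j))) \<le> C * r" if "0 \<le> r" for r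
  proof -
    have "(\<Sum>j<n. \<psi> (s j) * (r / s (Suc j))) = (\<Sum>j<n. \<psi> (s j) / s (Suc j)) * r"
      by (simp add: sum_distrib_right)
    also have "\<dots> \<le> C * r" using C that by (intro mult_right_mono) (simp_all add: s_def)
    finally show ?thesis .
  qed
  show "separately_convex H"
  proof -
    have "separately_convex (\<lambda>p. \<Sum>j<n. \<psi> (s j) *
        (case p of (x, y) \<Rightarrow> saddle (1 / s (Suc j) * x + 0, 1 / s (Suc j) * y + 0)))"
      by (intro separately_convex_sum separately_convex_cmult c_nonneg
          separately_convex_compose_affine separately_convex_saddle)
    then show ?thesis by (simp add: H_def case_prod_unfold)
  qed
  show "H (x, y) \<le> C * \<bar>x - y\<bar>" for x y
  proof -
    have "H (x, y) \<le> (\<Sum>j<n. \<psi> (s j) * (\<bar>x - y\<bar> / s (Suc j)))"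
      unfolding H_def prod.case
    proof (intro sum_mono mult_left_mono c_nonneg)
      fix j
      have "\<bar>x / s (Suc j) - y / s (Suc j)\<bar> = \<bar>x - y\<bar> / s (Suc j)"
        using s_pos[of "Suc j"] by (simp flip: diff_divide_distrib)
      then show "saddle (x / s (Suc j), y / s (Suc j)) \<le> \<bar>x - y\<bar> / s (Suc j)"
        using saddle_le by metis
    qed
    also have "\<dots> \<le> C * \<bar>x - y\<bar>" by (intro C') simp
    finally show ?thesis .
  qed
  show "- C * \<bar>t\<bar> \<le> H (t, t)" for t
  proof -
    have "- C * \<bar>t\<bar> \<le> - (\<Sum>j<n. \<psi> (s j) * (\<bar>t\<bar> / s (Suc j)))" using C'[of "\<bar>t\<bar>"] by simp
    also have "\<dots> = (\<Sum>j<n. \<psi> (s j) * - \<bar>t / s (Suc j)\<bar>)"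
      using s_pos by (simp add: sum_negf less_imp_le)
    also have "\<dots> \<le> H (t, t)"
      unfolding H_def prod.case by (intro sum_mono mult_left_mono c_nonneg saddle_diag_ge)
    finally show ?thesis .
  qed
  show "H (t, t) \<le> \<psi> (d / 2 ^ n) - \<psi> \<bar>t\<bar>" if "\<bar>t\<bar> \<le> d" for t
  proof -
    have summand: "\<psi> (s j) * saddle (t / s (Suc j), t / s (Suc j)) \<le> 0" for j
      using c_nonneg saddle_diag_nonpos by (intro mult_nonneg_nonpos)
    have H_nonpos: "H (t, t) \<le> 0"
      unfolding H_def prod.case by (intro sum_nonpos summand)
    show ?thesis
    proof (cases "\<bar>t\<bar> \<le> s n")
      case True
      then show ?thesis using mono[of "\<bar>t\<bar>" "s n"] H_nonpos by (simp add: s_def)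
    next
      case False
      \<comment> \<open>The first scale below \<open>\<bar>t\<bar>\<close>; it is not the scale
        \<open>s 0 = d\<close>, so it has a predecessor \<open>s j\<close> that is at least
        \<open>\<bar>t\<bar>\<close>.\<close>
      define k where "k = (LEAST k. s k < \<bar>t\<bar>)"
      have k: "s k < \<bar>t\<bar>" "k \<le> n"
        using LeastI[of "\<lambda>k. s k < \<bar>t\<bar>" n] Least_le[of "\<lambda>k. s k < \<bar>t\<bar>" n] False
        by (auto simp: k_def)
      moreover have "k \<noteq> 0"
      proof
        assume "k = 0"
        then show False using k(1) that by (simp add: s_def)
      qed
      ultimately obtain j where j: "k = Suc j" "j < n" by (cases k) auto
      have tj: "\<bar>t\<bar> \<le> s j" using not_less_Least[of j "\<lambda>k. s k < \<bar>t\<bar>"] j by (simp add: k_def)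
      have "1 \<le> \<bar>t / s (Suc j)\<bar>" using k j s_pos[of "Suc j"] by simp
      then have "\<psi> (s j) * saddle (t / s (Suc j), t / s (Suc j)) = - \<psi> (s j)"
        by (simp add: saddle_diag_far)
      moreover have "H (t, t) \<le> \<psi> (s j) * saddle (t / s (Suc j), t / s (Suc j))"
      proof -
        have "H (t, t) = \<psi> (s j) * saddle (t / s (Suc j), t / s (Suc j)) +
            (\<Sum>i\<in>{..<n} - {j}. \<psi> (s i) * saddle (t / s (Suc i), t / s (Suc i)))"
          unfolding H_def prod.case using j by (intro sum.remove) auto
        moreover have "(\<Sum>i\<in>{..<n} - {j}. \<psi> (s i) * saddle (t / s (Suc i), t / s (Suc i))) \<le> 0"
          by (intro sum_nonpos summand)
        ultimately show ?thesis by linarith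
      qed
      ultimately show ?thesis
        using mono[of "\<bar>t\<bar>" "s j"] tj c_nonneg[of n] by (simp add: s_def)
    qed
  qed
qed

section \<open>Suprema of glued pieces\<close>

lemma ex_bound_on_balls:
  fixes g :: "real \<Rightarrow> real"
  assumes "continuous_on UNIV g"
  obtains G where "\<And>(N::nat) t. \<bar>t\<bar> \<le> real N \<Longrightarrow> \<bar>g t\<bar> \<le> G N"
proof -
  have "\<exists>c. \<forall>t. \<bar>t\<bar> \<le> real N \<longrightarrow> \<bar>g t\<bar> \<le> c" for N
  proof -
    have "bounded (g ` {- real N..real N})"
      by (intro compact_imp_bounded compact_continuous_image continuous_on_subset[OF assms]) auto
    then obtain c where "\<forall>t\<in>{- real N..real N}. \<bar>g t\<bar> \<le> c" by (auto simp: bounded_iff)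
    then show ?thesis by (intro exI[of _ c]) (simp add: abs_le_iff)
  qed
  then show thesis using that by metis
qed

text \<open>Isolates what the supremum needs from \<open>g\<close>: at each \<open>u\<close> in
  \<open>D\<close> a slope \<open>s u\<close> and local minorants \<open>H\<close> whose growth is
  uniform for bounded \<open>u\<close> and whose value at the origin is at least
  \<open>- \<eta>\<close>, for every positive \<open>\<eta>\<close>.\<close>

lemma ex_separately_convex_extension:
  fixes g s :: "real \<Rightarrow> real" and D :: "real set" and \<delta> :: real and K :: "nat \<Rightarrow> real"
  assumes cont: "continuous_on UNIV g" and dense: "closure D = UNIV" and \<delta>: "0 < \<delta>" "\<delta> \<le> 1"
    and bound: "\<And>u N. u \<in> D \<Longrightarrow> \<bar>u\<bar> \<le> real N \<Longrightarrow> \<bar>g u\<bar> \<le> K N \<and> \<bar>s u\<bar> \<le> K N"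
    and pieces: "\<And>u N \<eta>. u \<in> D \<Longrightarrow> \<bar>u\<bar> \<le> real N \<Longrightarrow> 0 < \<eta> \<Longrightarrow> \<exists>H. separately_convex H \<and>
      (\<forall>x y. H (x, y) \<le> K N * \<bar>x - y\<bar>) \<and> (\<forall>t. - (K N * \<bar>t\<bar>) - \<eta> \<le> H (t, t)) \<and>
      (\<forall>t. \<bar>t\<bar> \<le> \<delta> \<longrightarrow> H (t, t) \<le> g (u + t) - g u - s u * t)"
  shows "\<exists>f. separately_convex f \<and> (\<forall>u. f (u, u) = g u)"
proof -
  obtain G where G: "\<And>(N::nat) t. \<bar>t\<bar> \<le> real N \<Longrightarrow> \<bar>g t\<bar> \<le> G N"
    using ex_bound_on_balls[OF cont] by blast
  obtain R P where R: "separately_convex R" "\<And>N t. real N \<le> \<bar>t\<bar> \<Longrightarrow> R (t, t) \<le> - G (Suc N)"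
    and P: "\<And>N x y. \<bar>x\<bar> \<le> real N \<Longrightarrow> \<bar>y\<bar> \<le> real N \<Longrightarrow> - P N \<le> R (x, y)"
    using ex_separately_convex_below_on_diagonal[of "\<lambda>N. G (Suc N)"] by blast
  \<comment> \<open>One \<open>\<bar>K i\<bar>\<close> absorbs \<open>g u\<close>, the other the
    linear term on the square around \<open>(u, u)\<close>. The index of \<open>P\<close> is raised
    by one because that square, of half-side at most \<open>1\<close>, lies in the square of
    half-side \<open>i + 1\<close> around the origin. \<open>b i\<close> collects the slopes in
    \<open>\<bar>x - y\<bar>\<close>.\<close>
  define \<alpha> where "\<alpha> i = 2 * \<bar>K i\<bar> + \<bar>P (Suc i)\<bar>" for i
  define b where "b i = \<bar>K i\<bar> + \<alpha> i / \<delta>" for i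
  have \<alpha>_nonneg: "0 \<le> \<alpha> i" for i by (simp add: \<alpha>_def)
  have b_nonneg: "0 \<le> b i" for i using \<alpha>_nonneg \<delta> by (simp add: b_def)
  obtain Z where Z: "separately_convex Z" "\<And>t. Z (t, t) = 0"
    "\<And>N x y. real N \<le> max \<bar>x\<bar> \<bar>y\<bar> \<Longrightarrow> (\<Sum>i\<le>N + 2. b i) * \<bar>x - y\<bar> \<le> Z (x, y)"
    using ex_separately_convex_steep[of "\<lambda>N. \<Sum>i\<le>N + 2. b i"] by blast
  \<comment> \<open>\<open>\<alpha>\<close> is chosen after \<open>R\<close> and \<open>Z\<close> after \<open>\<alpha>\<close>: on the boundary of the square around \<open>(u, u)\<close> the
    piece at \<open>u\<close> is then at most \<open>- \<bar>P\<bar> + b \<bar>x - y\<bar>\<close>, hence below \<open>R + Z\<close>.\<close>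
  define M where "M p = R p + Z p" for p
  have M: "separately_convex M"
    unfolding M_def by (intro separately_convex_add R Z)
  have M_diag: "M (t, t) \<le> g t" for t
  proof -
    \<comment> \<open>With \<open>N\<close> the integer part of \<open>\<bar>t\<bar>\<close>, the
      bound \<open>G (Suc N)\<close> is valid at \<open>t\<close>; hence the shift by one in the
      choice of \<open>R\<close>.\<close>
    have "real (nat \<lfloor>\<bar>t\<bar>\<rfloor>) \<le> \<bar>t\<bar>" "\<bar>t\<bar> \<le> real (Suc (nat \<lfloor>\<bar>t\<bar>\<rfloor>))" by linarith+
    then show ?thesis using R(2) G[of t] Z(2)[of t] unfolding M_def by fastforce
  qed
  define n where "n u = nat \<lceil>\<bar>u\<bar>\<rceil>" for u :: real
  have n: "\<bar>u\<bar> \<le> real (n u)" "real (n u) < \<bar>u\<bar> + 1" for u unfolding n_def by linarith+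
  \<comment> \<open>Averaging \<open>x\<close> and \<open>y\<close> makes the affine part restrict
    to the linearisation at \<open>u\<close> on the diagonal.\<close>
  define F where "F u H = (\<lambda>(x, y). g u + s u * ((x + y) / 2 - u) + H (x - u, y - u) +
      \<alpha> (n u) * saddle ((x - u) / \<delta>, (y - u) / \<delta>))" for u and H :: "real \<times> real \<Rightarrow> real"
  define A where "A u H = (\<lambda>(x, y). if \<bar>x - u\<bar> \<le> \<delta> \<and> \<bar>y - u\<bar> \<le> \<delta>
      then max (F u H (x, y)) (M (x, y)) else M (x, y))" for u H
  \<comment> \<open>The lower bound with \<open>\<eta>\<close> is left out of \<open>T\<close>: one
    index set then contains the pieces for all \<open>\<eta>\<close>, and the supremum can let
    \<open>\<eta>\<close> tend to zero.\<close>
  define T where "T = {(u, H). u \<in> D \<and> separately_convex H \<and>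
      (\<forall>x y. H (x, y) \<le> K (n u) * \<bar>x - y\<bar>) \<and>
      (\<forall>t. \<bar>t\<bar> \<le> \<delta> \<longrightarrow> H (t, t) \<le> g (u + t) - g u - s u * t)}"
  have F_convex: "separately_convex (F u H)" if "separately_convex H" for u H
  proof -
    have "separately_convex (\<lambda>(x, y). g u + s u * ((x + y) / 2 - u))"
    proof -
      have "g u + s u * ((x + y) / 2 - u) = s u / 2 * x + s u / 2 * y + (g u - s u * u)" for x y
        by (simp add: algebra_simps add_divide_distrib)
      then show ?thesis
        using separately_convex_affine[of "s u / 2" "s u / 2" "g u - s u * u"] by (simp only:)
    qed
    moreover have "separately_convex (\<lambda>(x, y). H (x - u, y - u))"
      using separately_convex_compose_affine[OF that, of 1 "- u"] by simp
    moreover have "separately_convex (\<lambda>(x, y). saddle ((x - u) / \<delta>, (y - u) / \<delta>))"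
      using separately_convex_compose_affine[OF separately_convex_saddle, of "1 / \<delta>" "- u / \<delta>"]
      by (simp add: diff_divide_distrib)
    ultimately have "separately_convex (\<lambda>p. (case p of (x, y) \<Rightarrow> g u + s u * ((x + y) / 2 - u)) +
        (case p of (x, y) \<Rightarrow> H (x - u, y - u)) +
        \<alpha> (n u) * (case p of (x, y) \<Rightarrow> saddle ((x - u) / \<delta>, (y - u) / \<delta>)))"
      by (intro separately_convex_add separately_convex_cmult \<alpha>_nonneg)
    then show ?thesis by (simp add: F_def case_prod_unfold)
  qed
  have F_le: "F u H (x, y) \<le> 2 * \<bar>K (n u)\<bar> + \<bar>K (n u)\<bar> * \<bar>x - y\<bar> +
      \<alpha> (n u) * saddle ((x - u) / \<delta>, (y - u) / \<delta>)"
    if "(u, H) \<in> T" "\<bar>x - u\<bar> \<le> \<delta>" "\<bar>y - u\<bar> \<le> \<delta>" for u H x y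
  proof -
    have u: "u \<in> D" and H: "H (x - u, y - u) \<le> K (n u) * \<bar>(x - u) - (y - u)\<bar>"
      using that(1) unfolding T_def by blast+
    have "\<bar>g u\<bar> \<le> K (n u)" "\<bar>s u\<bar> \<le> K (n u)" using bound[OF u n(1)] by auto
    moreover have "s u * ((x + y) / 2 - u) \<le> \<bar>K (n u)\<bar>"
    proof -
      have "\<bar>(x + y) / 2 - u\<bar> \<le> 1" using that \<delta> by (simp add: abs_le_iff field_simps)
      then have "\<bar>s u\<bar> * \<bar>(x + y) / 2 - u\<bar> \<le> \<bar>s u\<bar>" by (intro mult_left_le) auto
      then show ?thesis
        using \<open>\<bar>s u\<bar> \<le> K (n u)\<close> abs_ge_self[of "s u * ((x + y) / 2 - u)"]
        by (simp add: abs_mult)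
    qed
    moreover have "K (n u) * \<bar>(x - u) - (y - u)\<bar> = \<bar>K (n u)\<bar> * \<bar>x - y\<bar>"
      using \<open>\<bar>g u\<bar> \<le> K (n u)\<close> by simp
    ultimately show ?thesis using H unfolding F_def prod.case by linarith
  qed
  have scaled: "\<bar>(x - u) / \<delta> - (y - u) / \<delta>\<bar> = \<bar>x - y\<bar> / \<delta>" for x y u
    using \<delta> by (simp flip: diff_divide_distrib)
  have A_convex: "separately_convex (A u H)" if T: "(u, H) \<in> T" for u H
    unfolding A_def
  proof (rule separately_convex_glue_max[OF F_convex M])
    show "separately_convex H" using T by (simp add: T_def)
    fix x y
    assume xy: "\<bar>x - u\<bar> \<le> \<delta>" "\<bar>y - u\<bar> \<le> \<delta>" "\<bar>x - u\<bar> = \<delta> \<or> \<bar>y - u\<bar> = \<delta>"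
    have "saddle ((x - u) / \<delta>, (y - u) / \<delta>) = \<bar>x - y\<bar> / \<delta> - 1"
      unfolding scaled[symmetric, of x y u]
      using xy \<delta> by (intro saddle_boundary) auto
    then have "F u H (x, y) \<le> 2 * \<bar>K (n u)\<bar> + \<bar>K (n u)\<bar> * \<bar>x - y\<bar> + \<alpha> (n u) * (\<bar>x - y\<bar> / \<delta> - 1)"
      using F_le[OF T xy(1,2)] by simp
    also have "\<dots> = - \<bar>P (Suc (n u))\<bar> + b (n u) * \<bar>x - y\<bar>"
      by (simp add: \<alpha>_def b_def algebra_simps add_divide_distrib)
    also have "\<dots> \<le> R (x, y) + Z (x, y)"
    proof (rule add_mono)
      have "\<bar>x\<bar> \<le> real (Suc (n u))" "\<bar>y\<bar> \<le> real (Suc (n u))" using xy \<delta> n[of u] by linarith+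
      from P[OF this] show "- \<bar>P (Suc (n u))\<bar> \<le> R (x, y)" by linarith
      \<comment> \<open>A boundary point has a coordinate within \<open>1\<close> of
        \<open>u\<close>, and \<open>n u\<close> exceeds \<open>\<bar>u\<bar>\<close> by less than
        \<open>1\<close>. The offset \<open>2\<close> in the choice of \<open>Z\<close> makes
        \<open>b (n u)\<close> one of the summands, also when the subtraction truncates.\<close>
      have "real (n u - 2) \<le> max \<bar>x\<bar> \<bar>y\<bar>" using xy \<delta> n[of u] by linarith
      moreover have "b (n u) \<le> (\<Sum>i\<le>n u - 2 + 2. b i)" by (intro member_le_sum b_nonneg) auto
      then have "b (n u) * \<bar>x - y\<bar> \<le> (\<Sum>i\<le>n u - 2 + 2. b i) * \<bar>x - y\<bar>"
        by (intro mult_right_mono) auto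
      ultimately show "b (n u) * \<bar>x - y\<bar> \<le> Z (x, y)" using Z(3) by (meson order_trans)
    qed
    finally show "F u H (x, y) \<le> M (x, y)" by (simp add: M_def)
  qed
  have A_bdd: "bdd_above ((\<lambda>(u, H). A u H p) ` T)" for p
  proof -
    obtain x y where p: "p = (x, y)" by fastforce
    \<comment> \<open>\<open>w i\<close> bounds the pieces with \<open>n u = i\<close>. Only
      \<open>u\<close> within \<open>\<delta>\<close> of \<open>x\<close> contribute more than
      \<open>M\<close>, so finitely many \<open>i\<close> occur and their sum is a common
      bound.\<close>
    define w where "w i = 2 * \<bar>K i\<bar> + b i * \<bar>x - y\<bar>" for i
    have w_nonneg: "0 \<le> w i" for i using b_nonneg by (simp add: w_def)
    have sum_w_nonneg: "0 \<le> (\<Sum>i\<le>n x + 2. w i)" by (intro sum_nonneg w_nonneg)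
    have "A u H p \<le> \<bar>M p\<bar> + (\<Sum>i\<le>n x + 2. w i)" if T: "(u, H) \<in> T" for u H
    proof (cases "\<bar>x - u\<bar> \<le> \<delta> \<and> \<bar>y - u\<bar> \<le> \<delta>")
      case True
      have "saddle ((x - u) / \<delta>, (y - u) / \<delta>) \<le> \<bar>x - y\<bar> / \<delta>"
        unfolding scaled[symmetric, of x y u] by (rule saddle_le)
      then have "\<alpha> (n u) * saddle ((x - u) / \<delta>, (y - u) / \<delta>) \<le> \<alpha> (n u) * (\<bar>x - y\<bar> / \<delta>)"
        by (intro mult_left_mono \<alpha>_nonneg)
      then have "F u H (x, y) \<le> w (n u)"
        using F_le[OF T] True by (fastforce simp: w_def b_def algebra_simps)
      also have "w (n u) \<le> (\<Sum>i\<le>n x + 2. w i)"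
      proof (intro member_le_sum w_nonneg)
        have "real (n u) < real (n x) + 2" using True \<delta> n[of u] n[of x] by linarith
        then show "n u \<in> {..n x + 2}" by simp
      qed auto
      finally have "F u H (x, y) \<le> (\<Sum>i\<le>n x + 2. w i)" .
      moreover have "A u H p = max (F u H (x, y)) (M p)" using True by (simp add: A_def p)
      ultimately show ?thesis using sum_w_nonneg by linarith
    next
      case False
      then have "A u H p = M p" by (auto simp: A_def p)
      then show ?thesis using sum_w_nonneg by linarith
    qed
    then show ?thesis by (intro bdd_aboveI2[where M = "\<bar>M p\<bar> + (\<Sum>i\<le>n x + 2. w i)"]) auto
  qed
  have A_diag: "A u H (t, t) \<le> g t" if "(u, H) \<in> T" for u H t
  proof (cases "\<bar>t - u\<bar> \<le> \<delta>")
    case True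
    then have "H (t - u, t - u) \<le> g (u + (t - u)) - g u - s u * (t - u)"
      using that unfolding T_def by blast
    moreover have "\<alpha> (n u) * saddle ((t - u) / \<delta>, (t - u) / \<delta>) \<le> 0"
      using \<alpha>_nonneg saddle_diag_nonpos by (intro mult_nonneg_nonpos)
    ultimately have "F u H (t, t) \<le> g t" by (simp add: F_def)
    then show ?thesis using M_diag by (simp add: A_def)
  qed (use M_diag in \<open>simp add: A_def\<close>)
  have T_pieces: "\<exists>H. (u, H) \<in> T \<and> (\<forall>t. - (K (n u) * \<bar>t\<bar>) - \<eta> \<le> H (t, t))"
    if "u \<in> D" "0 < \<eta>" for u \<eta>
    using pieces[OF that(1) n(1) that(2)] that(1) unfolding T_def by blast
  have T_nonempty: "T \<noteq> {}"
  proof -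
    have "D \<noteq> {}" using dense by auto
    then show ?thesis using T_pieces[of _ 1] by fastforce
  qed
  define f where "f p = (SUP (u, H)\<in>T. A u H p)" for p
  have "separately_convex f"
  proof -
    have "separately_convex (\<lambda>p. SUP i\<in>T. (case i of (u, H) \<Rightarrow> A u H) p)"
      using A_bdd by (intro separately_convex_Sup T_nonempty)
        (auto simp: A_convex case_prod_unfold)
    then show ?thesis by (simp add: f_def[abs_def] case_prod_unfold)
  qed
  moreover have "f (v, v) = g v" for v
  proof (rule antisym)
    show "f (v, v) \<le> g v"
      unfolding f_def using A_diag by (intro cSUP_least T_nonempty) auto
    \<comment> \<open>The constant \<open>c\<close> bounds, uniformly for \<open>u\<close> near
      \<open>v\<close>, the linear losses along the diagonal: one \<open>\<bar>K i\<bar>\<close>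
      from the slope, one from \<open>H\<close>, and \<open>\<alpha> i / \<delta>\<close> from the
      saddle.\<close>
    define c where "c = (\<Sum>i\<le>n v + 2. 2 * \<bar>K i\<bar> + \<alpha> i / \<delta>)"
    have near: "g u - c * \<bar>v - u\<bar> \<le> f (v, v)" if u: "u \<in> D" and uv: "\<bar>v - u\<bar> \<le> \<delta>" for u
    proof (rule field_le_epsilon)
      fix \<eta> :: real assume "0 < \<eta>"
      then obtain H where H: "(u, H) \<in> T" "\<And>t. - (K (n u) * \<bar>t\<bar>) - \<eta> \<le> H (t, t)"
        using T_pieces[OF u] by blast
      have "2 * \<bar>K (n u)\<bar> + \<alpha> (n u) / \<delta> \<le> c"
        unfolding c_def
      proof (intro member_le_sum)
        have "real (n u) < real (n v) + 2" using uv \<delta> n[of u] n[of v] by linarith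
        then show "n u \<in> {..n v + 2}" by simp
      qed (use \<alpha>_nonneg \<delta> in auto)
      then have c: "(2 * \<bar>K (n u)\<bar> + \<alpha> (n u) / \<delta>) * \<bar>v - u\<bar> \<le> c * \<bar>v - u\<bar>"
        by (intro mult_right_mono) auto
      have su: "- (\<bar>K (n u)\<bar> * \<bar>v - u\<bar>) \<le> s u * (v - u)"
      proof -
        have "\<bar>s u\<bar> \<le> \<bar>K (n u)\<bar>" using bound[OF u n(1)] by linarith
        then have "\<bar>s u\<bar> * \<bar>v - u\<bar> \<le> \<bar>K (n u)\<bar> * \<bar>v - u\<bar>" by (intro mult_right_mono) auto
        then show ?thesis using abs_ge_minus_self[of "s u * (v - u)"] by (simp add: abs_mult)
      qed
      have "K (n u) * \<bar>v - u\<bar> \<le> \<bar>K (n u)\<bar> * \<bar>v - u\<bar>" by (intro mult_right_mono) auto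
      then have Hv: "- (\<bar>K (n u)\<bar> * \<bar>v - u\<bar>) - \<eta> \<le> H (v - u, v - u)"
        using H(2)[of "v - u"] by linarith
      have "- (\<alpha> (n u) / \<delta> * \<bar>v - u\<bar>) = \<alpha> (n u) * - \<bar>(v - u) / \<delta>\<bar>"
        using \<delta> by simp
      also have "\<dots> \<le> \<alpha> (n u) * saddle ((v - u) / \<delta>, (v - u) / \<delta>)"
        by (intro mult_left_mono \<alpha>_nonneg saddle_diag_ge)
      finally have "g u - c * \<bar>v - u\<bar> - \<eta> \<le> F u H (v, v)"
        using c su Hv unfolding F_def prod.case by (simp add: algebra_simps)
      also have "\<dots> \<le> A u H (v, v)" using uv by (simp add: A_def)
      also have "\<dots> \<le> f (v, v)"
        unfolding f_def using cSUP_upper[OF H(1) A_bdd[of "(v, v)"]] by simp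
      finally show "g u - c * \<bar>v - u\<bar> \<le> f (v, v) + \<eta>" by simp
    qed
    \<comment> \<open>Density lets \<open>u\<close> tend to \<open>v\<close>; the linear loss
      vanishes in the limit and continuity of \<open>g\<close> gives the remaining
      inequality.\<close>
    obtain U where U: "\<And>k. U k \<in> D" "U \<longlonglongrightarrow> v"
      using dense closure_sequential[of v D] by auto
    have "(\<lambda>k. g (U k) - c * \<bar>v - U k\<bar>) \<longlonglongrightarrow> g v - c * \<bar>v - v\<bar>"
      using cont U(2) by (intro tendsto_intros continuous_on_tendsto_compose[OF cont]) auto
    moreover have "\<forall>\<^sub>F k in sequentially. g (U k) - c * \<bar>v - U k\<bar> \<le> f (v, v)"
      using tendstoD[OF U(2) \<delta>(1)]
    proof eventually_elim
      case (elim k)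
      then show ?case using near[OF U(1)] by (simp add: dist_real_def abs_minus_commute)
    qed
    ultimately have "g v - c * \<bar>v - v\<bar> \<le> f (v, v)" by (intro tendsto_upperbound) auto
    then show "g v \<le> f (v, v)" by simp
  qed
  ultimately show ?thesis by blast
qed

section \<open>From the integral condition to dyadic sums\<close>

text \<open>On \<open>[r, 2 * r]\<close> the integrand is at least
  \<open>\<psi> r / (4 * r\<^sup>2)\<close>, so its integral there is at least one eighth of
  \<open>\<psi> r / (r / 2)\<close>. For \<open>r = d / 2 ^ j\<close> these intervals fit together
  inside \<open>[0, 2 * d]\<close>.\<close>

lemma dyadic_sum_le_integral:
  fixes \<psi> :: "real \<Rightarrow> real"
  assumes d: "0 < d" "2 * d \<le> e" and nonneg: "\<And>x. 0 \<le> x \<Longrightarrow> 0 \<le> \<psi> x"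
    and mono: "\<And>x y. 0 \<le> x \<Longrightarrow> x \<le> y \<Longrightarrow> \<psi> x \<le> \<psi> y"
    and int: "(\<lambda>x. \<psi> x / x\<^sup>2) integrable_on {0..e}"
  shows "(\<Sum>j<n. \<psi> (d / 2 ^ j) / (d / 2 ^ Suc j)) \<le> 8 * integral {0..e} (\<lambda>x. \<psi> x / x\<^sup>2)"
proof -
  let ?f = "\<lambda>x. \<psi> x / x\<^sup>2"
  have sub: "?f integrable_on {a..b}" if "0 \<le> a" "b \<le> e" for a b
    using integrable_on_subinterval[OF int] that by auto
  have "(\<Sum>j<n. \<psi> (d / 2 ^ j) / (d / 2 ^ Suc j)) \<le> 8 * integral {2 * d / 2 ^ n..2 * d} ?f"
  proof (induction n)
    case (Suc n)
    define r where "r = d / 2 ^ n"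
    have r: "0 < r" "r \<le> d" using d by (auto simp: r_def divide_simps)
    have "\<psi> r / (4 * r\<^sup>2) * r = integral {r..2 * r} (\<lambda>x. \<psi> r / (4 * r\<^sup>2))"
      using r by simp
    also have "\<dots> \<le> integral {r..2 * r} ?f"
    proof (rule integral_le)
      show "?f integrable_on {r..2 * r}" using sub r d by auto
      show "\<psi> r / (4 * r\<^sup>2) \<le> ?f x" if "x \<in> {r..2 * r}" for x
      proof (rule frac_le)
        have "x\<^sup>2 \<le> (2 * r)\<^sup>2" using that r by (intro power_mono) auto
        then show "x\<^sup>2 \<le> 4 * r\<^sup>2" by (simp add: power_mult_distrib)
      qed (use that r nonneg mono in auto)
    qed auto
    finally have "8 * (\<psi> r / (4 * r\<^sup>2) * r) \<le> 8 * integral {r..2 * r} ?f"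
      by (intro mult_left_mono) auto
    moreover have "\<psi> r / (r / 2) = 8 * (\<psi> r / (4 * r\<^sup>2) * r)"
      using r by (simp add: power2_eq_square)
    moreover have "integral {r..2 * r} ?f + integral {2 * r..2 * d} ?f = integral {r..2 * d} ?f"
      using r d by (intro Henstock_Kurzweil_Integration.integral_combine sub) auto
    moreover have "(\<Sum>j<n. \<psi> (d / 2 ^ j) / (d / 2 ^ Suc j)) \<le> 8 * integral {2 * r..2 * d} ?f"
      using Suc by (simp add: r_def)
    moreover have "d / 2 ^ Suc n = r / 2" "2 * d / 2 ^ Suc n = r" "d / 2 ^ n = r"
      by (simp_all add: r_def)
    ultimately show ?case unfolding sum.lessThan_Suc by (simp only:)
  qed simp
  also have "integral {2 * d / 2 ^ n..2 * d} ?f \<le> integral {0..e} ?f"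
    using d nonneg by (intro integral_subset_le sub int) auto
  finally show ?thesis by simp
qed

section \<open>Sign and monotonicity of \<open>phi\<close>\<close>

text \<open>A real \<open>Inf\<close> is a lower bound only for sets bounded below; here this
  follows from continuity on a compact interval.\<close>

lemma phi_le:
  assumes "continuous_on UNIV g" "\<bar>t\<bar> \<le> x"
  shows "phi g u x \<le> g (u + t) - g u - deriv g u * t"
proof -
  have "compact {t. \<bar>t\<bar> \<le> x}"
  proof -
    have "{t. \<bar>t\<bar> \<le> x} = {- x..x}" by auto
    then show ?thesis by simp
  qed
  then have "compact ((\<lambda>t. g (u + t) - g u - deriv g u * t) ` {t. \<bar>t\<bar> \<le> x})"
    by (intro compact_continuous_image continuous_intros continuous_on_compose2[OF assms(1)]) auto
  then have "bdd_below ((\<lambda>t. g (u + t) - g u - deriv g u * t) ` {t. \<bar>t\<bar> \<le> x})"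
    by (intro bounded_imp_bdd_below compact_imp_bounded)
  then show ?thesis
    unfolding phi_def using assms(2) by (intro cINF_lower) auto
qed

lemma phi_nonpos: "continuous_on UNIV g \<Longrightarrow> 0 \<le> x \<Longrightarrow> phi g u x \<le> 0"
  using phi_le[of g 0 x u] by simp

lemma phi_antimono:
  assumes "continuous_on UNIV g" "0 \<le> x" "x \<le> y"
  shows "phi g u y \<le> phi g u x"
  unfolding phi_def[of g u x]
proof (rule cINF_greatest)
  have "0 \<in> {t. \<bar>t\<bar> \<le> x}" using assms by simp
  then show "{t. \<bar>t\<bar> \<le> x} \<noteq> {}" by blast
qed (use assms in \<open>auto intro: phi_le\<close>)

lemma locally_lipschitz_imp_continuous_on:
  assumes "locally_lipschitz g"
  shows "continuous_on UNIV g"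
proof -
  have "isCont g x" for x
  proof -
    obtain e L where "0 < e" "L-lipschitz_on (ball x e) g"
      using assms unfolding locally_lipschitz_def by blast
    then have "continuous_on (ball x e) g" by (intro lipschitz_on_continuous_on)
    then show ?thesis using \<open>0 < e\<close> by (simp add: continuous_on_eq_continuous_at)
  qed
  then show ?thesis by (simp add: continuous_at_imp_continuous_on)
qed

theorem theorem7p2:
  fixes g :: "real \<Rightarrow> real" and D :: "real set" and \<epsilon> :: real
  assumes "locally_lipschitz g"
    and "\<epsilon> > 0"
    and "closure D = UNIV"
    and "\<forall>u\<in>D. g differentiable (at u)"
    and "\<forall>u\<in>D. (\<lambda>x. phi g u x / x\<^sup>2) integrable_on {0..\<epsilon>}"
    and "\<forall>S. bounded S \<longrightarrow>
           (\<exists>B. \<forall>u\<in>D \<inter> S. \<bar>integral {0..\<epsilon>} (\<lambda>x. phi g u x / x\<^sup>2)\<bar> \<le> B)"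
  shows "\<exists>f :: real \<times> real \<Rightarrow> real. separately_convex f \<and> (\<forall>u. f (u, u) = g u)"
proof -
  note cont = locally_lipschitz_imp_continuous_on[OF assms(1)]
  obtain G where G: "\<And>(N::nat) t. \<bar>t\<bar> \<le> real N \<Longrightarrow> \<bar>g t\<bar> \<le> G N"
    using ex_bound_on_balls[OF cont] by blast
  have "\<exists>B. \<forall>u\<in>D \<inter> {- real N..real N}. \<bar>integral {0..\<epsilon>} (\<lambda>x. phi g u x / x\<^sup>2)\<bar> \<le> B" for N
    using assms(6) by simp
  then obtain B where B: "\<And>N u. u \<in> D \<Longrightarrow> \<bar>u\<bar> \<le> real N \<Longrightarrow>
      \<bar>integral {0..\<epsilon>} (\<lambda>x. phi g u x / x\<^sup>2)\<bar> \<le> B N"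
    by (metis IntI abs_le_iff atLeastAtMost_iff minus_le_iff)
  \<comment> \<open>Half of \<open>\<epsilon>\<close> keeps the dyadic intervals, which reach up to
    \<open>2 * \<delta>\<close>, inside the range of integration; the bound \<open>1\<close> is
    required for the gluing.\<close>
  define \<delta> where "\<delta> = min (\<epsilon> / 2) 1"
  have \<delta>: "0 < \<delta>" "\<delta> \<le> 1" "2 * \<delta> \<le> \<epsilon>" using assms(2) by (auto simp: \<delta>_def)
  define C where "C N = 8 * \<bar>B N\<bar>" for N
  \<comment> \<open>The three summands serve the bound on \<open>g u\<close>, the growth of
    \<open>H\<close>, and, together with \<open>C N\<close>, the bound on the derivative.\<close>
  define K where "K N = \<bar>G (Suc N)\<bar> + C N + 2 * \<bar>G (Suc N)\<bar> / \<delta>" for N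
  have C_nonneg: "0 \<le> C N" for N by (simp add: C_def)
  have K: "\<bar>G (Suc N)\<bar> \<le> K N" "C N \<le> K N" "2 * \<bar>G (Suc N)\<bar> / \<delta> + C N \<le> K N" for N
    using \<delta> C_nonneg[of N] by (auto simp: K_def)
  have nonneg: "0 \<le> - phi g u x" if "0 \<le> x" for u x
    using phi_nonpos[OF cont that] by simp
  have mono: "- phi g u x \<le> - phi g u y" if "0 \<le> x" "x \<le> y" for u x y
    using phi_antimono[OF cont that] by simp
  have dyadic: "(\<Sum>j<k. - phi g u (\<delta> / 2 ^ j) / (\<delta> / 2 ^ Suc j)) \<le> C N"
    if "u \<in> D" "\<bar>u\<bar> \<le> real N" for u N k
  proof -
    have "(\<lambda>x. - phi g u x / x\<^sup>2) integrable_on {0..\<epsilon>}"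
      using assms(5) that(1) by (simp add: integrable_neg_iff)
    from dyadic_sum_le_integral[OF \<delta>(1,3) nonneg mono this]
    have "(\<Sum>j<k. - phi g u (\<delta> / 2 ^ j) / (\<delta> / 2 ^ Suc j))
        \<le> 8 * integral {0..\<epsilon>} (\<lambda>x. - phi g u x / x\<^sup>2)" .
    also have "\<dots> \<le> C N" using B[OF that] by (simp add: C_def)
    finally show ?thesis .
  qed
  \<comment> \<open>A single nonnegative term is at most the whole sum. Hence the truncation error
    \<open>- phi g u (\<delta> / 2 ^ j)\<close> tends to zero, uniformly for bounded
    \<open>u\<close>.\<close>
  have phi_dyadic: "- phi g u (\<delta> / 2 ^ j) \<le> C N * (\<delta> / 2 ^ j)"
    if "u \<in> D" "\<bar>u\<bar> \<le> real N" for u N j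
  proof -
    have "- phi g u (\<delta> / 2 ^ j) / (\<delta> / 2 ^ Suc j)
        \<le> (\<Sum>j<Suc j. - phi g u (\<delta> / 2 ^ j) / (\<delta> / 2 ^ Suc j))"
      using \<delta> by (intro member_le_sum divide_nonneg_nonneg nonneg) auto
    also have "\<dots> \<le> C N" using dyadic[OF that] .
    finally have "- phi g u (\<delta> / 2 ^ j) \<le> C N * (\<delta> / 2 ^ Suc j)"
      by (subst (asm) pos_divide_le_eq) (use \<delta> in simp_all)
    also have "\<dots> \<le> C N * (\<delta> / 2 ^ j)"
      using \<delta> C_nonneg by (intro mult_left_mono) (auto simp: field_simps)
    finally show ?thesis .
  qed
  show ?thesis
  proof (rule ex_separately_convex_extension[OF cont assms(3) \<delta>(1,2), where s = "deriv g" and K = K])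
    fix u N
    assume u: "u \<in> D" "\<bar>u\<bar> \<le> real N"
    \<comment> \<open>The bound on \<open>\<phi>\<^sub>u (\<delta>)\<close> at \<open>t = \<plusminus>\<delta>\<close> also bounds the derivative.\<close>
    have Gu: "\<bar>g u\<bar> \<le> \<bar>G (Suc N)\<bar>" "\<bar>g (u + \<delta>)\<bar> \<le> \<bar>G (Suc N)\<bar>" "\<bar>g (u + - \<delta>)\<bar> \<le> \<bar>G (Suc N)\<bar>"
      using u \<delta> by (intro order.trans[OF G abs_ge_self]; simp)+
    have "- (C N * \<delta>) \<le> g (u + \<delta>) - g u - deriv g u * \<delta>"
      "- (C N * \<delta>) \<le> g (u + - \<delta>) - g u - deriv g u * - \<delta>"
      using phi_dyadic[OF u, of 0] phi_le[OF cont, of "\<delta>" \<delta> u] phi_le[OF cont, of "- \<delta>" \<delta> u] \<delta>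
      by auto
    then have "\<bar>deriv g u * \<delta>\<bar> \<le> 2 * \<bar>G (Suc N)\<bar> + C N * \<delta>"
      using Gu unfolding mult_minus_right by linarith
    then have "\<bar>deriv g u\<bar> \<le> 2 * \<bar>G (Suc N)\<bar> / \<delta> + C N"
      using \<delta> by (simp add: abs_mult field_simps)
    then show "\<bar>g u\<bar> \<le> K N \<and> \<bar>deriv g u\<bar> \<le> K N"
      using Gu(1) K[of N] by linarith
    fix \<eta> :: real
    assume "0 < \<eta>"
    have "(\<lambda>k. C N * (\<delta> / 2 ^ k)) \<longlonglongrightarrow> C N * 0"
      by (intro tendsto_intros LIMSEQ_divide_realpow_zero) auto
    then have "\<forall>\<^sub>F k in sequentially. C N * (\<delta> / 2 ^ k) < \<eta>"
      using \<open>0 < \<eta>\<close> by (intro order_tendstoD) auto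
    then obtain k where k: "C N * (\<delta> / 2 ^ k) < \<eta>"
      by (auto simp: eventually_sequentially)
    obtain H where H: "separately_convex H" "\<And>x y. H (x, y) \<le> C N * \<bar>x - y\<bar>"
      "\<And>t. - C N * \<bar>t\<bar> \<le> H (t, t)"
      "\<And>t. \<bar>t\<bar> \<le> \<delta> \<Longrightarrow> H (t, t) \<le> - phi g u (\<delta> / 2 ^ k) - - phi g u \<bar>t\<bar>"
      using separately_convex_dyadic_saddles[OF \<delta>(1) nonneg mono dyadic[OF u], of k] by metis
    \<comment> \<open>Adding the nonpositive value \<open>phi g u (\<delta> / 2 ^ k)\<close> cancels
      the truncation error on the diagonal, leaving at most \<open>phi g u \<bar>t\<bar>\<close>;
      the lower bound drops by less than \<open>\<eta>\<close>.\<close>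
    let ?H = "\<lambda>p. H p + phi g u (\<delta> / 2 ^ k)"
    have CK: "C N * \<bar>r\<bar> \<le> K N * \<bar>r\<bar>" for r using K by (intro mult_right_mono) auto
    show "\<exists>H. separately_convex H \<and> (\<forall>x y. H (x, y) \<le> K N * \<bar>x - y\<bar>) \<and>
        (\<forall>t. - (K N * \<bar>t\<bar>) - \<eta> \<le> H (t, t)) \<and>
        (\<forall>t. \<bar>t\<bar> \<le> \<delta> \<longrightarrow> H (t, t) \<le> g (u + t) - g u - deriv g u * t)"
    proof (intro exI[of _ ?H] conjI allI impI)
      show "separately_convex ?H"
        by (intro separately_convex_add H separately_convex_const)
      show "?H (x, y) \<le> K N * \<bar>x - y\<bar>" for x y
        using H(2)[of x y] CK[of "x - y"] nonneg[of "\<delta> / 2 ^ k" u] \<delta> by simp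
      show "- (K N * \<bar>t\<bar>) - \<eta> \<le> ?H (t, t)" for t
        using H(3)[of t] CK[of t] phi_dyadic[OF u, of k] k by simp
      show "?H (t, t) \<le> g (u + t) - g u - deriv g u * t" if "\<bar>t\<bar> \<le> \<delta>" for t
        using H(4)[OF that] phi_le[OF cont, of t "\<bar>t\<bar>" u] by simp
    qed
  qed
qed

end
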